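(* Let $0<\alpha<1$ and $\beta\ge0$, and let $\Phi_{\alpha,\beta}(s)=s^\alpha\bigl(1+(1-\alpha)s^{\alpha-1}\bigr)^{-\beta}$. There exists $k_{\alpha,\beta}\in L^1_{\mathrm{loc}}(0,\infty)$ such that $$\mathcal{L}[k_{\alpha,\beta}](s)=\frac{1}{\Phi_{\alpha,\beta}(s)},\qquad\Re s>0.$$ Moreover, $$k_{\alpha,\beta}(t)=t^{\alpha-1}E^{-\beta}_{1-\alpha,\,\alpha}\bigl(-(1-\alpha)t^{1-\alpha}\bigr),\qquad t>0,$$ and there exists $C>0$ such that $$|k_{\alpha,\beta}(t)|\le C\,t^{\alpha-1}\quad(0<t\le1),\qquad k_{\alpha,\beta}\in L^1_{\mathrm{loc}}(0,\infty).$$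
   Context: Complex powers are principal branches on $\mathbb{C}\setminus(-\infty,0]$. $\mathcal{L}[g](s)=\int_0^\infty e^{-st}g(t)\,dt$ is the Laplace transform. $L^1_{\mathrm{loc}}(0,\infty)$ means integrable on $(0,T)$ for every finite $T>0$. The Prabhakar (three-parameter Mittag-Leffler) function is $E^\gamma_{\rho,\delta}(z)=\sum_{n\ge0}\frac{(\gamma)_n}{n!\,\Gamma(\rho n+\delta)}z^n$, with $(\gamma)_n=\gamma(\gamma+1)\cdots(\gamma+n-1)$, $(\gamma)_0=1$. *)

theory Defs
  imports "HOL-Analysis.Analysis"
begin

text \<open>Complex \<open>powr\<close> is the principal branch: the cut of the logarithm is
  \<open>(-\<infinity>, 0]\<close>.\<close>

definition Phi :: "real \<Rightarrow> real \<Rightarrow> complex \<Rightarrow> complex" where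
  "Phi \<alpha> \<beta> s =
     s powr of_real \<alpha> *
     (1 + of_real (1 - \<alpha>) * s powr of_real (\<alpha> - 1)) powr of_real (- \<beta>)"

text \<open>The Prabhakar function \<open>E\<^sup>\<gamma>\<^bsub>\<rho>,\<delta>\<^esub>(z)\<close>. At a pole of \<open>\<Gamma>\<close>,
  \<^term>\<open>Gamma\<close> is \<open>0\<close>, so the corresponding term vanishes, as it does under the usual convention
  \<open>1/\<Gamma> = 0\<close> there.\<close>

definition prabhakar :: "'a \<Rightarrow> 'a \<Rightarrow> 'a \<Rightarrow> 'a \<Rightarrow> 'a :: Gamma" where
  "prabhakar \<gamma> \<rho> \<delta> z =
     (\<Sum>n. pochhammer \<gamma> n / (fact n * Gamma (\<rho> * of_nat n + \<delta>)) * z ^ n)"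

text \<open>Integrability is required on all of \<open>(0,T)\<close>, up to the endpoint \<open>0\<close>,
  not only on the compact subsets of \<open>(0,\<infinity>)\<close>.\<close>

definition L1_loc :: "(real \<Rightarrow> 'a :: euclidean_space) \<Rightarrow> bool" where
  "L1_loc g \<longleftrightarrow> (\<forall>T>0. g absolutely_integrable_on {0<..<T})"

text \<open>The Laplace transform is a relation here because the Bochner integral of a non-integrable
  function is \<open>0\<close>: \<open>has_laplace g s L\<close> states that the integral converges absolutely
  and has the value \<open>L\<close>.\<close>

definition has_laplace :: "(real \<Rightarrow> complex) \<Rightarrow> complex \<Rightarrow> complex \<Rightarrow> bool" where
  "has_laplace g s L \<longleftrightarrow>
     (\<lambda>t. exp (- s * of_real t) * g t) absolutely_integrable_on {0<..} \<and>
     (LINT t:{0<..}|lebesgue. exp (- s * of_real t) * g t) = L"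

end

theory Submission
  imports Defs "HOL-Complex_Analysis.Complex_Analysis"
begin

text \<open>For real \<open>\<sigma> > 1\<close> the series defining the kernel \<open>k\<close> can be integrated term by term
  against \<open>exp (- \<sigma> * t)\<close>, and the binomial series gives \<open>F(\<sigma>)\<close>, where \<open>F = 1 / \<Phi>\<close>.
  The difficulty is to reach all \<open>s\<close> with \<open>Re s > 0\<close>, since termwise estimates only give
  exponential bounds on \<open>k\<close>. The function \<open>F\<close> is completely monotone: with
  \<open>u(s) = 1 / (s powr (1 - \<alpha>) + (1 - \<alpha>))\<close>,
  \<open>- F' / F = \<alpha> / s + \<beta> * (1 - \<alpha>)\<^sup>2 * u / s\<close>,
  and each factor on the right solves a similar equation \<open>- y' = g * y ^ m\<close> with \<open>g\<close> completely
  monotone. So all moments \<open>\<integral> t ^ n * exp (- \<sigma> * t) * k t\<close> with \<open>\<sigma> > 1\<close> are nonnegative, which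
  forces \<open>k \<ge> 0\<close>. Finally \<open>F\<close> is holomorphic in the right half-plane, so its Taylor series at
  \<open>\<sigma>\<close> converges in the disc of radius \<open>\<sigma>\<close>; as \<open>k \<ge> 0\<close>, Landau's argument shows that the
  Laplace integral converges absolutely to \<open>F\<close> there, and these discs exhaust \<open>Re s > 0\<close>.\<close>

subsection \<open>Nonnegative Taylor coefficients\<close>

text \<open>For the expansion of \<open>f(\<sigma> - h)\<close> in powers of \<open>h\<close>, this
  says that \<open>(-1)^n\<close> times the \<open>n\<close>-th derivative of \<open>f\<close> at
  \<open>\<sigma>\<close> is real and nonnegative: complete monotonicity at the point
  \<open>\<sigma>\<close>.\<close>

definition nonneg_coeffs :: "complex fps \<Rightarrow> bool" where
  "nonneg_coeffs F \<longleftrightarrow> (\<forall>n. fps_nth F n \<in> \<real>\<^sub>\<ge>\<^sub>0)"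

lemma nonneg_Reals_sum:
  assumes "\<And>i. i \<in> A \<Longrightarrow> f i \<in> \<real>\<^sub>\<ge>\<^sub>0"
  shows "sum f A \<in> (\<real>\<^sub>\<ge>\<^sub>0 :: complex set)"
  using assms by (induction A rule: infinite_finite_induct) auto

lemma nonneg_coeffs_add: "nonneg_coeffs F \<Longrightarrow> nonneg_coeffs G \<Longrightarrow> nonneg_coeffs (F + G)"
  by (simp add: nonneg_coeffs_def)

lemma nonneg_coeffs_mult: "nonneg_coeffs F \<Longrightarrow> nonneg_coeffs G \<Longrightarrow> nonneg_coeffs (F * G)"
  by (auto simp: nonneg_coeffs_def fps_mult_nth intro!: nonneg_Reals_sum)

lemma nonneg_coeffs_const: "c \<in> \<real>\<^sub>\<ge>\<^sub>0 \<Longrightarrow> nonneg_coeffs (fps_const c)"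
  by (simp add: nonneg_coeffs_def)

text \<open>Comparing coefficients expresses \<open>(k + 1) * A_(k+1)\<close> through sums of
  products of coefficients of \<open>G\<close> and coefficients of \<open>A\<close> of index at most
  \<open>k\<close>, so strong induction applies.\<close>

lemma nonneg_coeffs_ode:
  assumes "fps_deriv A = G * A ^ m" "nonneg_coeffs G" "fps_nth A 0 \<in> \<real>\<^sub>\<ge>\<^sub>0"
  shows "nonneg_coeffs A"
proof -
  have "fps_nth A n \<in> \<real>\<^sub>\<ge>\<^sub>0" for n
  proof (induction n rule: less_induct)
    case (less n)
    show ?case
    proof (cases n)
      case (Suc k)
      \<comment> \<open>Only indices up to \<open>k\<close> are available from the outer induction
        hypothesis, and they suffice for the coefficients of the product up to
        \<open>k\<close>.\<close>
      have pw: "fps_nth (A ^ m) j \<in> \<real>\<^sub>\<ge>\<^sub>0" if "j \<le> k" for j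
        using that
        by (induction m arbitrary: j)
           (auto simp: fps_mult_nth Suc intro!: nonneg_Reals_sum nonneg_Reals_mult_I less.IH)
      have "of_nat (Suc k) * fps_nth A (Suc k) = fps_nth (G * A ^ m) k"
        unfolding assms(1)[symmetric] by simp
      hence "fps_nth A (Suc k) = fps_nth (G * A ^ m) k / of_nat (Suc k)"
        by (simp add: field_simps del: of_nat_Suc)
      moreover have "fps_nth (G * A ^ m) k \<in> \<real>\<^sub>\<ge>\<^sub>0"
        using assms(2)
        by (auto simp: fps_mult_nth nonneg_coeffs_def intro!: nonneg_Reals_sum nonneg_Reals_mult_I pw)
      ultimately show ?thesis using Suc by (simp del: of_nat_Suc)
    qed (use assms in auto)
  qed
  thus ?thesis by (simp add: nonneg_coeffs_def)
qed

text \<open>Uniqueness of expansions turns the differential equation into its formal counterpart.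
  The exponent \<open>m = 1\<close> serves powers and logarithmic derivatives, \<open>m = 2\<close>
  serves reciprocals.\<close>

lemma ode_nonneg_expansion:
  fixes f g :: "complex \<Rightarrow> complex"
  assumes "r > 0"
    and der: "\<And>z. z \<in> ball 0 r \<Longrightarrow> (f has_field_derivative g z * f z ^ m) (at z)"
    and g: "g has_fps_expansion G" "nonneg_coeffs G" and f0: "f 0 \<in> \<real>\<^sub>\<ge>\<^sub>0"
  obtains A where "f has_fps_expansion A" "nonneg_coeffs A"
proof
  have hol: "f holomorphic_on ball 0 r"
    using der by (meson field_differentiable_at_within field_differentiable_def holomorphic_on_def)
  show A: "f has_fps_expansion fps_expansion f 0"
    using hol assms(1) by (intro has_fps_expansion_fps_expansion[of "ball 0 r"]) auto
  have "deriv f has_fps_expansion fps_deriv (fps_expansion f 0)"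
    by (intro fps_expansion_intros A)
  moreover have "eventually (\<lambda>z. deriv f z = g z * f z ^ m) (nhds 0)"
    by (rule eventually_mono[OF eventually_nhds_in_open[of "ball 0 r"]])
       (use assms(1) DERIV_imp_deriv der in auto)
  ultimately have "(\<lambda>z. g z * f z ^ m) has_fps_expansion fps_deriv (fps_expansion f 0)"
    by (subst (asm) has_fps_expansion_cong) auto
  moreover have "(\<lambda>z. g z * f z ^ m) has_fps_expansion G * fps_expansion f 0 ^ m"
    by (intro fps_expansion_intros A g)
  ultimately have "fps_deriv (fps_expansion f 0) = G * fps_expansion f 0 ^ m"
    by (rule fps_expansion_unique_complex)
  thus "nonneg_coeffs (fps_expansion f 0)"
    by (rule nonneg_coeffs_ode[OF _ g(2)]) (use f0 in \<open>simp add: fps_expansion_def\<close>)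
qed

section \<open>Principal powers in the right half-plane and the logarithmic derivative of
  \<open>1 / Phi\<close>\<close>

lemma Re_powr_pos:
  assumes "Re s > 0" "\<bar>x\<bar> \<le> 1"
  shows "Re (s powr of_real x) > 0"
proof -
  have s: "s \<noteq> 0" using assms by auto
  \<comment> \<open>The argument of \<open>s\<close> lies in \<open>(-pi/2, pi/2)\<close>, and
    scaling it by \<open>x\<close> with \<open>\<bar>x\<bar> \<le> 1\<close> keeps it there, so its
    cosine stays positive.\<close>
  have "\<bar>Im (Ln s)\<bar> < pi / 2" using assms s Re_Ln_pos_lt by blast
  hence "\<bar>x * Im (Ln s)\<bar> < pi / 2"
    using assms(2) mult_right_mono[OF assms(2), of "\<bar>Im (Ln s)\<bar>"] by (simp add: abs_mult)
  hence "cos (x * Im (Ln s)) > 0" by (intro cos_gt_zero_pi) auto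
  thus ?thesis using s by (simp add: powr_def Re_exp)
qed

lemma Re_pos_nonpos_Reals: "Re s > 0 \<Longrightarrow> s \<notin> \<real>\<^sub>\<le>\<^sub>0"
  by (auto simp: complex_nonpos_Reals_iff)

lemma inverse_Phi_eq:
  "1 / Phi \<alpha> \<beta> s =
     s powr of_real (- \<alpha>) * (1 + of_real (1 - \<alpha>) * s powr of_real (\<alpha> - 1)) powr of_real \<beta>"
  by (simp add: Phi_def powr_minus divide_inverse)

lemma inverse_Phi_of_real:
  assumes "s > 0" "\<alpha> < 1"
  shows "1 / Phi \<alpha> \<beta> (of_real s) =
    of_real (s powr (- \<alpha>) * (1 + (1 - \<alpha>) * s powr (\<alpha> - 1)) powr \<beta>)"
proof -
  have p: "complex_of_real s powr of_real x = of_real (s powr x)" for x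
    using assms by (subst powr_of_real) auto
  have q: "1 + complex_of_real (1 - \<alpha>) * of_real (s powr (\<alpha> - 1)) = of_real (1 + (1 - \<alpha>) * s powr (\<alpha> - 1))"
    by simp
  show ?thesis
    unfolding inverse_Phi_eq p q using assms
    by (subst powr_of_real) auto
qed

context
  fixes \<alpha> \<beta> :: real
  assumes \<alpha>: "0 < \<alpha>" "\<alpha> < 1" and \<beta>: "\<beta> \<ge> 0"
begin

text \<open>This keeps the base of the outer power off the branch cut, so that
  \<open>1 / Phi\<close> is differentiable there.\<close>

lemma Re_base_pos:
  assumes "Re s > 0"
  shows "Re (1 + of_real (1 - \<alpha>) * s powr of_real (\<alpha> - 1)) > 0"
  using Re_powr_pos[OF assms, of "\<alpha> - 1"] \<alpha> by (simp add: add_pos_pos)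

text \<open>The negative logarithmic derivative is arranged as a combination, with nonnegative
  coefficients, of products of reciprocals whose expansions can be treated one after
  another.\<close>

lemma inverse_Phi_has_derivative:
  assumes "Re s > 0"
  shows "((\<lambda>s. 1 / Phi \<alpha> \<beta> s) has_field_derivative
    - (of_real \<alpha> * (1 / s) + of_real (\<beta> * (1 - \<alpha>)\<^sup>2) * ((1 / s) * (1 / (s powr of_real (1 - \<alpha>) + of_real (1 - \<alpha>)))))
      * (1 / Phi \<alpha> \<beta> s)) (at s)"
proof -
  define w where "w = 1 + of_real (1 - \<alpha>) * s powr of_real (\<alpha> - 1)"
  have s0: "s \<noteq> 0" "s \<notin> \<real>\<^sub>\<le>\<^sub>0" using assms Re_pos_nonpos_Reals by auto
  have "Re w > 0" using Re_base_pos[OF assms] by (simp only: w_def)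
  hence w: "w \<noteq> 0" "w \<notin> \<real>\<^sub>\<le>\<^sub>0" using Re_pos_nonpos_Reals by auto
  have d: "((\<lambda>s. 1 / Phi \<alpha> \<beta> s) has_field_derivative
      of_real (- \<alpha>) * s powr (of_real (- \<alpha>) - 1) * w powr of_real \<beta> +
      s powr of_real (- \<alpha>) * (of_real \<beta> * w powr (of_real \<beta> - 1) *
        (of_real (1 - \<alpha>) * (of_real (\<alpha> - 1) * s powr (of_real (\<alpha> - 1) - 1))))) (at s)"
  proof -
    note p = has_field_derivative_powr[OF s0(2)]
    have dw: "((\<lambda>s. 1 + of_real (1 - \<alpha>) * s powr of_real (\<alpha> - 1)) has_field_derivative
        of_real (1 - \<alpha>) * (of_real (\<alpha> - 1) * s powr (of_real (\<alpha> - 1) - 1))) (at s)"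
      using DERIV_add[OF DERIV_const DERIV_cmult[OF p]] by (simp only: add_0_left)
    note dW = DERIV_chain2[OF has_field_derivative_powr[OF w(2)[unfolded w_def]] dw]
    show ?thesis unfolding inverse_Phi_eq w_def
      by (rule DERIV_cong[OF DERIV_mult[OF p dW]]) (simp only: mult_ac)
  qed
  have e1: "s powr (of_real (- \<alpha>) - 1) = s powr of_real (- \<alpha>) / s"
    using s0 by (simp add: powr_diff)
  have e2: "w powr (of_real \<beta> - 1) = w powr of_real \<beta> / w"
    using w by (simp add: powr_diff)
  have e3: "s powr (of_real (\<alpha> - 1) - 1) = s powr of_real (\<alpha> - 1) / s"
    using s0 by (simp add: powr_diff power2_eq_square)
  \<comment> \<open>Multiplying numerator and denominator of
    \<open>(1 - \<alpha>) * s powr (\<alpha> - 1) / w\<close> by \<open>u\<close> leaves the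
    denominator \<open>u + (1 - \<alpha>)\<close>.\<close>
  define u where "u = s powr of_real (1 - \<alpha>)"
  have u0: "u \<noteq> 0" using s0 by (simp add: u_def)
  have u: "s powr of_real (\<alpha> - 1) = 1 / u"
    using powr_minus[of s "of_real (1 - \<alpha>)"] by (simp add: u_def divide_inverse)
  have wu: "w = (u + of_real (1 - \<alpha>)) / u" unfolding w_def u using u0 by (simp add: field_simps)
  have ua: "u + of_real (1 - \<alpha>) \<noteq> 0"
    using w(1) unfolding wu by (intro notI) simp
  have e4: "of_real (1 - \<alpha>) * (1 / u) / w = of_real (1 - \<alpha>) / (u + of_real (1 - \<alpha>))"
    using u0 ua unfolding wu by (simp del: of_real_diff)
  have e5: "of_real (\<alpha> - 1) * (of_real (1 - \<alpha>) * (1 / u)) / w =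
      - of_real ((1 - \<alpha>)\<^sup>2) * (1 / (u + of_real (1 - \<alpha>)))"
  proof -
    have m: "of_real (\<alpha> - 1) = - complex_of_real (1 - \<alpha>)" by simp
    have "of_real (\<alpha> - 1) * (x / w) = - of_real ((1 - \<alpha>)\<^sup>2) * (1 / y)"
      if "x / w = of_real (1 - \<alpha>) / y" for x y
      unfolding that m by (simp add: power2_eq_square del: of_real_diff)
    from this[OF e4] show ?thesis by (simp only: times_divide_eq_right)
  qed
  \<comment> \<open>\<open>g1\<close> and \<open>g2\<close> are the ring identities behind
    \<open>f1\<close> and \<open>f2\<close>; in \<open>g1\<close>, the variables \<open>i\<close>,
    \<open>j\<close>, \<open>x\<close> stand for the inverses of \<open>s\<close>, \<open>w\<close>,
    \<open>u\<close>.\<close>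
  have g1: "(- A) * (S * i) * W + S * (B * (W * j) * (C * (D * (x * i)))) =
      S * W * (- A * i + B * i * (D * (C * x) * j))" for A B C D S W i j x :: complex
    by (simp add: algebra_simps)
  have g2: "X * (- A * q + B * q * (- C * r)) = - (A * q + B * C * (q * r)) * X"
    for A B C X q r :: complex
    by (simp add: algebra_simps)
  have f1: "of_real (- \<alpha>) * (S / s) * W + S * (of_real \<beta> * (W / w) *
        (of_real (1 - \<alpha>) * (of_real (\<alpha> - 1) * (1 / u / s)))) =
      (S * W) * (- of_real \<alpha> * (1 / s) +
        of_real \<beta> * (1 / s) * (of_real (\<alpha> - 1) * (of_real (1 - \<alpha>) * (1 / u)) / w))" for S W
    unfolding divide_inverse mult_1_left of_real_minus by (rule g1)
  have f2: "(S * W) * (- of_real \<alpha> * (1 / s) +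
        of_real \<beta> * (1 / s) * (of_real (\<alpha> - 1) * (of_real (1 - \<alpha>) * (1 / u)) / w)) = - (of_real \<alpha> * (1 / s) + of_real (\<beta> * (1 - \<alpha>)\<^sup>2) * ((1 / s) * (1 / (u + of_real (1 - \<alpha>))))) *
      (S * W)" for S W
    unfolding e5 of_real_mult by (rule g2)
  have "((\<lambda>s. 1 / Phi \<alpha> \<beta> s) has_field_derivative
    - (of_real \<alpha> * (1 / s) + of_real (\<beta> * (1 - \<alpha>)\<^sup>2) * ((1 / s) * (1 / (u + of_real (1 - \<alpha>))))) *
      (s powr of_real (- \<alpha>) * w powr of_real \<beta>)) (at s)"
    using d unfolding e1 e2 e3 u f1 f2 .
  thus ?thesis unfolding inverse_Phi_eq u_def w_def .
qed

text \<open>Expanding in \<open>h = \<sigma> - s\<close> turns complete monotonicity into nonnegativity of the coefficients.\<close>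

lemma inverse_Phi_expansion:
  assumes "\<sigma> > 0"
  obtains A where "(\<lambda>h. 1 / Phi \<alpha> \<beta> (of_real \<sigma> - h)) has_fps_expansion A" "nonneg_coeffs A"
proof -
  have Re: "Re (of_real \<sigma> - z) > 0" if "(z :: complex) \<in> ball 0 \<sigma>" for z
    using that abs_Re_le_cmod[of z] by (simp add: dist_norm)
  have nz: "complex_of_real \<sigma> - z \<noteq> 0" "complex_of_real \<sigma> - z \<notin> \<real>\<^sub>\<le>\<^sub>0"
    if "z \<in> ball 0 \<sigma>" for z using Re[OF that] Re_pos_nonpos_Reals by auto
  have pr: "complex_of_real \<sigma> powr of_real x = of_real (\<sigma> powr x)" for x
    using assms by (subst powr_of_real) auto
  define q where "q = (\<lambda>z. 1 / (complex_of_real \<sigma> - z))"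
  define p where "p = (\<lambda>z. (complex_of_real \<sigma> - z) powr of_real (- \<alpha>))"
  define u where "u = (\<lambda>z. 1 / ((complex_of_real \<sigma> - z) powr of_real (1 - \<alpha>) + of_real (1 - \<alpha>)))"
  \<comment> \<open>As \<open>d/dh = - d/ds\<close>, all signs become positive. The chain is
    \<open>q' = q^2\<close>, \<open>p' = \<alpha> q p\<close>,
    \<open>u' = (1 - \<alpha>) p u^2\<close> and at last \<open>f' = g f\<close> with
    \<open>g\<close> built from \<open>q\<close> and \<open>u\<close>; each right-hand side uses the
    series found before.\<close>
  have "(q has_field_derivative (\<lambda>_. 1) z * q z ^ 2) (at z)" if "z \<in> ball 0 \<sigma>" for z
    unfolding q_def using nz[OF that]
    by (auto intro!: derivative_eq_intros simp: field_simps power2_eq_square)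
  moreover have "q 0 \<in> \<real>\<^sub>\<ge>\<^sub>0" using assms by (simp add: q_def)
  ultimately obtain Q where Q: "q has_fps_expansion Q" "nonneg_coeffs Q"
    using ode_nonneg_expansion[OF assms, of q "\<lambda>_. 1" 2 1] nonneg_coeffs_const[of 1] by auto
  have "(p has_field_derivative (of_real \<alpha> * q z) * p z ^ 1) (at z)" if "z \<in> ball 0 \<sigma>" for z
    unfolding p_def q_def using nz[OF that]
    by (auto intro!: derivative_eq_intros simp: powr_diff)
  moreover have "(\<lambda>z. of_real \<alpha> * q z) has_fps_expansion fps_const (of_real \<alpha>) * Q"
    by (intro fps_expansion_intros Q)
  moreover have "nonneg_coeffs (fps_const (of_real \<alpha>) * Q)"
    using \<alpha> by (intro nonneg_coeffs_mult nonneg_coeffs_const Q) auto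
  moreover have "p 0 \<in> \<real>\<^sub>\<ge>\<^sub>0" unfolding p_def using pr[of "-\<alpha>"] by simp
  ultimately obtain P where P: "p has_fps_expansion P" "nonneg_coeffs P"
    by (rule ode_nonneg_expansion[OF assms])
  have "(u has_field_derivative (of_real (1 - \<alpha>) * p z) * u z ^ 2) (at z)"
    if z: "z \<in> ball 0 \<sigma>" for z
  proof -
    define v where "v = (complex_of_real \<sigma> - z) powr of_real (1 - \<alpha>) + of_real (1 - \<alpha>)"
    have "Re v > 0" using Re_powr_pos[OF Re[OF z], of "1 - \<alpha>"] \<alpha> by (simp add: v_def)
    hence v0: "v \<noteq> 0" by auto
    have e: "of_real (1 - \<alpha>) - 1 = complex_of_real (- \<alpha>)" by simp
    have "(u has_field_derivative
       - ((0 - 1) * (of_real (1 - \<alpha>) * (complex_of_real \<sigma> - z) powr (of_real (1 - \<alpha>) - 1))) / v\<^sup>2) (at z)"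
      unfolding u_def using nz[OF z] v0 unfolding v_def
      by (auto intro!: derivative_eq_intros simp: power2_eq_square)
    thus ?thesis unfolding e by (simp add: u_def p_def v_def power_divide)
  qed
  moreover have "(\<lambda>z. of_real (1 - \<alpha>) * p z) has_fps_expansion fps_const (of_real (1 - \<alpha>)) * P"
    by (intro fps_expansion_intros P)
  moreover have "nonneg_coeffs (fps_const (of_real (1 - \<alpha>)) * P)"
    using \<alpha> by (intro nonneg_coeffs_mult nonneg_coeffs_const P) (auto simp del: of_real_diff)
  moreover have "u 0 \<in> \<real>\<^sub>\<ge>\<^sub>0"
  proof -
    have "u 0 = of_real (1 / (\<sigma> powr (1 - \<alpha>) + (1 - \<alpha>)))" unfolding u_def using pr[of "1 - \<alpha>"] by simp
    thus ?thesis using \<alpha> by (simp del: of_real_divide of_real_add of_real_diff)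
  qed
  ultimately obtain U where U: "u has_fps_expansion U" "nonneg_coeffs U"
    by (rule ode_nonneg_expansion[OF assms])
  let ?c = "\<beta> * (1 - \<alpha>)\<^sup>2"
  let ?g = "\<lambda>z. of_real \<alpha> * q z + of_real ?c * (q z * u z)"
  let ?G = "fps_const (of_real \<alpha>) * Q + fps_const (of_real ?c) * (Q * U)"
  let ?f = "\<lambda>h. 1 / Phi \<alpha> \<beta> (of_real \<sigma> - h)"
  have "(?f has_field_derivative ?g z * ?f z ^ 1) (at z)" if z: "z \<in> ball 0 \<sigma>" for z
  proof -
    have "((\<lambda>h. of_real \<sigma> - h) has_field_derivative -1) (at z)"
      by (auto intro!: derivative_eq_intros)
    from DERIV_chain2[OF inverse_Phi_has_derivative[OF Re[OF z]] this]
    show ?thesis by (rule DERIV_cong) (simp only: q_def u_def power_one_right mult_minus_right mult_minus_left minus_minus mult_1_right)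
  qed
  moreover have "?g has_fps_expansion ?G" by (intro fps_expansion_intros Q U)
  moreover have "nonneg_coeffs ?G"
    using \<alpha> \<beta> by (intro nonneg_coeffs_add nonneg_coeffs_mult nonneg_coeffs_const Q U)
      (auto simp del: of_real_mult of_real_power of_real_diff)
  moreover have "?f 0 \<in> \<real>\<^sub>\<ge>\<^sub>0"
    using inverse_Phi_of_real[OF assms \<alpha>(2), of \<beta>] by (simp del: of_real_mult)
  ultimately obtain A where "?f has_fps_expansion A" "nonneg_coeffs A"
    by (rule ode_nonneg_expansion[OF assms])
  thus thesis by (rule that)
qed

end

subsection \<open>Laplace integrals on the half-line\<close>

abbreviation lborel_pos :: "real measure" where
  "lborel_pos \<equiv> restrict_space lborel {0<..}"

text \<open>The analysis runs over the Borel measure on the half-line, whereas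
  \<open>has_laplace\<close> and \<open>L1_loc\<close> refer to \<open>lebesgue\<close>; completing
  the measure changes neither integrability nor the value.\<close>

lemma integrable_lborel_pos_imp_lebesgue:
  fixes f :: "real \<Rightarrow> 'a :: euclidean_space"
  assumes "integrable lborel_pos f"
  shows "set_integrable lebesgue {0<..} f" "(LINT t:{0<..}|lebesgue. f t) = integral\<^sup>L lborel_pos f"
proof -
  have i: "integrable lborel (\<lambda>x. indicator {0<..} x *\<^sub>R f x)"
    using assms by (subst (asm) integrable_restrict_space) auto
  show "set_integrable lebesgue {0<..} f"
    unfolding set_integrable_def using i integrable_completion[OF borel_measurable_integrable[OF i]] by blast
  show "(LINT t:{0<..}|lebesgue. f t) = integral\<^sup>L lborel_pos f"
    unfolding set_lebesgue_integral_def
    using integral_completion[OF borel_measurable_integrable[OF i]]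
    by (simp add: integral_restrict_space)
qed

text \<open>Euler's integral after the substitution \<open>x = \<sigma> * t\<close>. Nonnegative
  integrals yield integrability together with the value; the factor \<open>\<sigma> powr p\<close>,
  cancelled at the end, avoids division in \<open>ennreal\<close>.\<close>

lemma laplace_powr:
  fixes \<sigma> p :: real
  assumes "\<sigma> > 0" "p > 0"
  shows "has_bochner_integral lborel_pos (\<lambda>t. exp (- \<sigma> * t) * t powr (p - 1)) (Gamma p * \<sigma> powr (- p))"
proof (rule has_bochner_integral_nn_integral)
  have "ennreal (\<sigma> powr p) * (\<integral>\<^sup>+ t. ennreal (exp (- \<sigma> * t) * t powr (p - 1)) \<partial>lborel_pos) =
    (\<integral>\<^sup>+ t. ennreal \<sigma> * ennreal (indicator {0..} (0 + \<sigma> * t) * (0 + \<sigma> * t) powr (p - 1) / exp (0 + \<sigma> * t)) \<partial>lborel)"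
    using assms
    by (simp add: nn_integral_restrict_space flip: nn_integral_cmult)
       (intro nn_integral_cong, auto simp: indicator_def powr_mult powr_diff exp_minus field_simps
          zero_le_mult_iff simp flip: ennreal_mult')
  also have "\<dots> = ennreal (Gamma p)"
    using assms nn_integral_real_affine[of "\<lambda>t. ennreal (indicator {0..} t * t powr (p - 1) / exp t)" \<sigma> 0]
    by (simp add: Gamma_conv_nn_integral_real nn_integral_cmult)
  finally have eq: "ennreal (\<sigma> powr p) * (\<integral>\<^sup>+ t. ennreal (exp (- \<sigma> * t) * t powr (p - 1)) \<partial>lborel_pos) = ennreal (Gamma p)" .
  have "ennreal (\<sigma> powr - p) * ennreal (\<sigma> powr p) = 1"
    using assms by (simp flip: ennreal_mult' powr_add)
  hence "(\<integral>\<^sup>+ t. ennreal (exp (- \<sigma> * t) * t powr (p - 1)) \<partial>lborel_pos) =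
     ennreal (\<sigma> powr - p) * (ennreal (\<sigma> powr p) * (\<integral>\<^sup>+ t. ennreal (exp (- \<sigma> * t) * t powr (p - 1)) \<partial>lborel_pos))"
    by (simp flip: mult.assoc)
  also have "\<dots> = ennreal (Gamma p * \<sigma> powr (- p))"
    unfolding eq using assms by (simp add: mult.commute flip: ennreal_mult')
  finally show "(\<integral>\<^sup>+ t. ennreal (exp (- \<sigma> * t) * t powr (p - 1)) \<partial>lborel_pos) = ennreal (Gamma p * \<sigma> powr (- p))" .
qed (use assms in \<open>auto simp: measurable_restrict_space1\<close>)

section \<open>Moments and Taylor expansions of Laplace integrals\<close>

lemma exp_sums: "(\<lambda>n. x ^ n / fact n) sums exp (x :: 'a :: {real_normed_field, banach})"
  using exp_converges[of x] by (simp add: scaleR_conv_of_real divide_inverse mult.commute)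

lemma sum_pow_fact_le_exp:
  fixes x :: real
  assumes "x \<ge> 0" "finite I"
  shows "(\<Sum>n\<in>I. x ^ n / fact n) \<le> exp x"
  using sum_le_suminf[of "\<lambda>n. x ^ n / fact n" I] exp_sums[of x] assms by (simp add: sums_iff)

lemma exp_shift_mult: "exp (r * t) * (exp (- \<sigma> * t) * x) = exp (- (\<sigma> - r) * t) * (x :: 'a :: {real_normed_field, banach})"
proof -
  have "exp (r * t) * exp (- \<sigma> * t) = exp (- (\<sigma> - r) * t)"
    unfolding exp_add[symmetric] by (simp add: algebra_simps)
  thus ?thesis by (simp only: mult.assoc[symmetric])
qed

text \<open>Since \<open>(r * t)^n / n! \<le> exp (r * t)\<close>, a power of \<open>t\<close> costs
  only a shift of the exponent by \<open>r\<close>.\<close>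

lemma laplace_moment_integrable:
  fixes k :: "real \<Rightarrow> real"
  assumes k: "k \<in> borel_measurable lborel_pos" and "r > 0"
    and int: "integrable lborel_pos (\<lambda>t. exp (- (\<sigma> - r) * t) * \<bar>k t\<bar>)"
  shows "integrable lborel_pos (\<lambda>t. t ^ n / fact n * (exp (- \<sigma> * t) * k t))"
proof (rule Bochner_Integration.integrable_bound)
  show "integrable lborel_pos (\<lambda>t. (1 / r ^ n) * (exp (- (\<sigma> - r) * t) * \<bar>k t\<bar>))"
    using int by (rule integrable_mult_right)
  show "(\<lambda>t. t ^ n / fact n * (exp (- \<sigma> * t) * k t)) \<in> borel_measurable lborel_pos"
    using k by (intro borel_measurable_times k) (auto simp: measurable_restrict_space1)
  have "t ^ n / fact n * exp (- \<sigma> * t) \<le> 1 / r ^ n * exp (- (\<sigma> - r) * t)" if "t > 0" for t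
  proof -
    have "(r * t) ^ n / fact n * exp (- \<sigma> * t) \<le> exp (r * t) * exp (- \<sigma> * t)"
      using sum_pow_fact_le_exp[of "r * t" "{n}"] assms that by (intro mult_right_mono) auto
    also have "\<dots> = exp (- (\<sigma> - r) * t)" by (simp add: algebra_simps flip: exp_add)
    finally show ?thesis using assms by (simp add: field_simps power_mult_distrib)
  qed
  hence "t ^ n / fact n * exp (- \<sigma> * t) * \<bar>k t\<bar> \<le> 1 / r ^ n * exp (- (\<sigma> - r) * t) * \<bar>k t\<bar>" if "t > 0" for t
    using that by (intro mult_right_mono) auto
  thus "AE t in lborel_pos. norm (t ^ n / fact n * (exp (- \<sigma> * t) * k t)) \<le> norm ((1 / r ^ n) * (exp (- (\<sigma> - r) * t) * \<bar>k t\<bar>))"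
    using \<open>r > 0\<close> by (intro AE_I2) (auto simp: abs_mult mult.assoc space_restrict_space)
qed

text \<open>Expand \<open>exp (z * t)\<close> under the integral: the partial sums are dominated by
  \<open>exp (r * t)\<close> times the integrand, even for \<open>norm z = r\<close>.\<close>

lemma laplace_taylor:
  fixes k :: "real \<Rightarrow> real" and z :: complex
  assumes k: "k \<in> borel_measurable lborel_pos" and r: "r > 0" and z: "norm z \<le> r"
    and int: "integrable lborel_pos (\<lambda>t. exp (- (\<sigma> - r) * t) * \<bar>k t\<bar>)"
  shows "(\<lambda>n. of_real (LINT t|lborel_pos. t ^ n / fact n * (exp (- \<sigma> * t) * k t)) * z ^ n) sums
           (LINT t|lborel_pos. exp (- (of_real \<sigma> - z) * of_real t) * of_real (k t))"
proof -
  let ?m = "\<lambda>n t. t ^ n / fact n * (exp (- \<sigma> * t) * k t)"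
  let ?s = "\<lambda>N t. \<Sum>n<N. of_real (?m n t) * z ^ n"
  have mi: "integrable lborel_pos (?m n)" for n
    by (rule laplace_moment_integrable[OF k r int])
  have mi': "integrable lborel_pos (\<lambda>t. of_real (?m n t) * z ^ n)" for n
    using mi by (intro integrable_mult_left integrable_of_real)
  have "(\<lambda>N. integral\<^sup>L lborel_pos (?s N)) \<longlonglongrightarrow>
     (LINT t|lborel_pos. exp (- (of_real \<sigma> - z) * of_real t) * of_real (k t))"
  proof (rule integral_dominated_convergence[OF _ _ int])
    show "(\<lambda>t. exp (- (of_real \<sigma> - z) * of_real t) * of_real (k t)) \<in> borel_measurable lborel_pos"
      using k by (intro borel_measurable_times) (auto simp: measurable_restrict_space1)
    show "?s N \<in> borel_measurable lborel_pos" for N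
      using mi' by (intro borel_measurable_sum) auto
    have conv: "(\<lambda>N. ?s N t) \<longlonglongrightarrow> exp (- (of_real \<sigma> - z) * of_real t) * of_real (k t)" for t
    proof -
      have "(\<lambda>n. (z * of_real t) ^ n / fact n) sums exp (z * of_real t)"
        by (rule exp_sums)
      hence "(\<lambda>n. (z * of_real t) ^ n / fact n * of_real (exp (- \<sigma> * t) * k t)) sums
          (exp (z * of_real t) * of_real (exp (- \<sigma> * t) * k t))" by (rule sums_mult2)
      also have "(\<lambda>n. (z * of_real t) ^ n / fact n * of_real (exp (- \<sigma> * t) * k t)) = (\<lambda>n. of_real (?m n t) * z ^ n)"
        by (auto simp: power_mult_distrib)
      also have "exp (z * of_real t) * of_real (exp (- \<sigma> * t) * k t) = exp (- (of_real \<sigma> - z) * of_real t) * of_real (k t)"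
        using exp_shift_mult[of z "of_real t" "of_real \<sigma>" "of_real (k t)"]
        by (simp only: of_real_mult exp_of_real[symmetric] of_real_minus)
      finally show ?thesis by (simp only: sums_def)
    qed
    thus "AE t in lborel_pos. (\<lambda>N. ?s N t) \<longlonglongrightarrow> exp (- (of_real \<sigma> - z) * of_real t) * of_real (k t)"
      by (intro AE_I2)
    have bd: "norm (?s N t) \<le> exp (- (\<sigma> - r) * t) * \<bar>k t\<bar>" if "t > 0" for N t
    proof -
      have "norm (?s N t) \<le> (\<Sum>n<N. (r * t) ^ n / fact n * (exp (- \<sigma> * t) * \<bar>k t\<bar>))"
      proof (rule sum_norm_le)
        fix n
        have "norm z ^ n \<le> r ^ n" using z by (intro power_mono) auto
        hence "norm z ^ n * (t ^ n / fact n * (exp (- \<sigma> * t) * \<bar>k t\<bar>)) \<le> r ^ n * (t ^ n / fact n * (exp (- \<sigma> * t) * \<bar>k t\<bar>))"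
          using that by (intro mult_right_mono) auto
        thus "norm (of_real (?m n t) * z ^ n) \<le> (r * t) ^ n / fact n * (exp (- \<sigma> * t) * \<bar>k t\<bar>)"
          using that by (simp add: norm_mult norm_power norm_divide abs_mult power_mult_distrib mult_ac)
      qed
      also have "\<dots> \<le> exp (r * t) * (exp (- \<sigma> * t) * \<bar>k t\<bar>)"
      proof -
        have "(\<Sum>n<N. (r * t) ^ n / fact n) \<le> exp (r * t)"
          using r that by (intro sum_pow_fact_le_exp) auto
        hence "(\<Sum>n<N. (r * t) ^ n / fact n) * (exp (- \<sigma> * t) * \<bar>k t\<bar>) \<le>
            exp (r * t) * (exp (- \<sigma> * t) * \<bar>k t\<bar>)" by (rule mult_right_mono) simp
        thus ?thesis by (simp only: sum_distrib_right)
      qed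
      also have "\<dots> = exp (- (\<sigma> - r) * t) * \<bar>k t\<bar>" by (rule exp_shift_mult)
      finally show ?thesis .
    qed
    thus "AE t in lborel_pos. norm (?s N t) \<le> exp (- (\<sigma> - r) * t) * \<bar>k t\<bar>" for N
      by (intro AE_I2) (auto simp: space_restrict_space)
  qed
  also have "(\<lambda>N. integral\<^sup>L lborel_pos (?s N)) =
      (\<lambda>N. \<Sum>n<N. of_real (integral\<^sup>L lborel_pos (?m n)) * z ^ n)"
  proof
    fix N
    have "integral\<^sup>L lborel_pos (?s N) = (\<Sum>n<N. (LINT t|lborel_pos. of_real (?m n t) * z ^ n))"
      using mi' by (intro Bochner_Integration.integral_sum)
    also have "\<dots> = (\<Sum>n<N. of_real (integral\<^sup>L lborel_pos (?m n)) * z ^ n)"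
      by (intro sum.cong refl) (simp only: integral_mult_left_zero integral_complex_of_real)
    finally show "integral\<^sup>L lborel_pos (?s N) = \<dots>" .
  qed
  finally show ?thesis by (simp only: sums_def)
qed

text \<open>The step of Landau's argument where the sign of \<open>k\<close> enters: all terms are
  nonnegative, so the integrals of their norms are the given moments times \<open>r^n\<close>, and
  their summability makes the summed function integrable.\<close>

lemma laplace_integrable_extend:
  fixes k :: "real \<Rightarrow> real"
  assumes k: "\<And>t. t > 0 \<Longrightarrow> k t \<ge> 0" and r: "r \<ge> 0"
    and int: "\<And>n. integrable lborel_pos (\<lambda>t. t ^ n / fact n * (exp (- \<sigma> * t) * k t))"
    and sm: "summable (\<lambda>n. (LINT t|lborel_pos. t ^ n / fact n * (exp (- \<sigma> * t) * k t)) * r ^ n)"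
  shows "integrable lborel_pos (\<lambda>t. exp (- (\<sigma> - r) * t) * k t)"
proof -
  let ?f = "\<lambda>n t. t ^ n / fact n * (exp (- \<sigma> * t) * k t) * r ^ n"
  have s: "(\<lambda>n. ?f n t) sums (exp (- (\<sigma> - r) * t) * k t)" for t
  proof -
    have "(\<lambda>n. (r * t) ^ n / fact n * (exp (- \<sigma> * t) * k t)) sums (exp (r * t) * (exp (- \<sigma> * t) * k t))"
      by (intro sums_mult2 exp_sums)
    moreover have "(r * t) ^ n / fact n * (exp (- \<sigma> * t) * k t) = ?f n t" for n
      by (simp add: power_mult_distrib)
    ultimately show ?thesis unfolding exp_shift_mult by (simp only:)
  qed
  have n: "norm (?f n t) = ?f n t" if "t > 0" for n t
    using k[OF that] r that by (simp add: abs_mult)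
  have "integrable lborel_pos (\<lambda>t. \<Sum>n. ?f n t)"
  proof (rule integrable_suminf)
    show "integrable lborel_pos (?f n)" for n using int by (intro integrable_mult_left)
    show "AE t in lborel_pos. summable (\<lambda>n. norm (?f n t))"
    proof (intro AE_I2)
      fix t assume "t \<in> space lborel_pos"
      hence "t > 0" by (simp add: space_restrict_space)
      thus "summable (\<lambda>n. norm (?f n t))" using s[of t] by (simp only: n sums_iff)
    qed
    have "(LINT t|lborel_pos. norm (?f n t)) = (LINT t|lborel_pos. t ^ n / fact n * (exp (- \<sigma> * t) * k t)) * r ^ n" for n
    proof -
      have "(LINT t|lborel_pos. norm (?f n t)) = (LINT t|lborel_pos. ?f n t)"
        by (intro Bochner_Integration.integral_cong refl n) (simp add: space_restrict_space)
      thus ?thesis by (simp only: integral_mult_left_zero)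
    qed
    thus "summable (\<lambda>n. LINT t|lborel_pos. norm (?f n t))" using sm by (simp only:)
  qed
  also have "(\<lambda>t. \<Sum>n. ?f n t) = (\<lambda>t. exp (- (\<sigma> - r) * t) * k t)"
    using s by (auto simp only: sums_iff)
  finally show ?thesis .
qed

text \<open>The kernel \<open>t ^ n * exp (- \<sigma> * t)\<close> with \<open>\<sigma> = n / t\<^sub>0\<close> concentrates at \<open>t\<^sub>0\<close> as \<open>n\<close> grows.\<close>

lemma nonneg_if_laplace_moments_nonneg:
  fixes k :: "real \<Rightarrow> real"
  assumes cont: "continuous_on {0<..} k"
    and int: "\<And>\<sigma> n. \<sigma> > \<sigma>\<^sub>0 \<Longrightarrow> integrable lborel_pos (\<lambda>t. t ^ n / fact n * (exp (- \<sigma> * t) * k t))"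
    and nonneg: "\<And>\<sigma> n. \<sigma> > \<sigma>\<^sub>0 \<Longrightarrow> (LINT t|lborel_pos. t ^ n / fact n * (exp (- \<sigma> * t) * k t)) \<ge> 0"
    and t0: "t\<^sub>0 > 0"
  shows "k t\<^sub>0 \<ge> 0"
proof (rule ccontr)
  assume neg: "\<not> k t\<^sub>0 \<ge> 0"
  \<comment> \<open>Half of the absolute value of \<open>k\<close> at the point, so that continuity
    gives \<open>k t \<le> - c\<close> on a whole neighbourhood.\<close>
  define c where "c = - k t\<^sub>0 / 2"
  have c: "c > 0" using neg by (simp add: c_def)
  have "isCont k t\<^sub>0" using cont t0 by (simp add: continuous_on_eq_continuous_at)
  then obtain d where d: "d > 0" "\<And>t. \<bar>t - t\<^sub>0\<bar> < d \<Longrightarrow> \<bar>k t - k t\<^sub>0\<bar> < c"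
    using c unfolding continuous_at_eps_delta dist_real_def by blast
  define e where "e = min (d / 2) (t\<^sub>0 / 2)"
  have e: "e > 0" "e < d" "e < t\<^sub>0" using d t0 by (auto simp: e_def)
  have kc: "k t \<le> - c" if "\<bar>t - t\<^sub>0\<bar> \<le> e" for t
  proof -
    have "\<bar>k t - k t\<^sub>0\<bar> < c" using that e by (intro d) auto
    thus ?thesis unfolding c_def by linarith
  qed
  \<comment> \<open>Up to the factor \<open>fact n\<close>, the power \<open>\<phi>^n\<close> is the
    moment kernel with \<open>\<sigma> = n / t\<^sub>0\<close>; \<open>\<phi>\<close> increases
    strictly up to \<open>t\<^sub>0\<close> and decreases strictly afterwards.\<close>
  define \<phi> where "\<phi> = (\<lambda>t::real. t * exp (- t / t\<^sub>0))"
  have der: "(\<phi> has_real_derivative (1 - t / t\<^sub>0) * exp (- t / t\<^sub>0)) (at t)" for t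
    unfolding \<phi>_def using t0 by (auto intro!: derivative_eq_intros simp: field_simps)
  have inc: "\<phi> s < \<phi> t" if "s < t" "t \<le> t\<^sub>0" for s t
    using that(1)
  proof (rule DERIV_pos_imp_increasing_open)
    fix x assume "s < x" "x < t"
    thus "\<exists>y. (\<phi> has_real_derivative y) (at x) \<and> y > 0"
      using that t0 by (intro exI[of _ "(1 - x / t\<^sub>0) * exp (- x / t\<^sub>0)"] conjI der) (auto simp: field_simps)
  qed (use der in \<open>meson DERIV_isCont continuous_at_imp_continuous_on\<close>)
  have dec: "\<phi> t < \<phi> s" if "s < t" "t\<^sub>0 \<le> s" for s t
    using that(1)
  proof (rule DERIV_neg_imp_decreasing_open)
    fix x assume "s < x" "x < t"
    thus "\<exists>y. (\<phi> has_real_derivative y) (at x) \<and> y < 0"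
      using that t0 by (intro exI[of _ "(1 - x / t\<^sub>0) * exp (- x / t\<^sub>0)"] conjI der) (auto simp: field_simps mult_less_0_iff)
  qed (use der in \<open>meson DERIV_isCont continuous_at_imp_continuous_on\<close>)
  define M where "M = max (\<phi> (t\<^sub>0 - e)) (\<phi> (t\<^sub>0 + e))"
  have pos: "\<phi> t > 0" if "t > 0" for t using that by (simp add: \<phi>_def)
  have M0: "M > 0" using pos[of "t\<^sub>0 - e"] e by (simp add: M_def less_max_iff_disj)
  have outer: "\<phi> t \<le> M" if "\<bar>t - t\<^sub>0\<bar> > e" for t
  proof (cases "t < t\<^sub>0")
    case True
    thus ?thesis using that inc[of t "t\<^sub>0 - e"] e unfolding M_def by auto
  next
    case False
    thus ?thesis using that dec[of "t\<^sub>0 + e" t] e unfolding M_def by auto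
  qed
  \<comment> \<open>A level strictly between the bound \<open>M\<close> outside the
    \<open>e\<close>-neighbourhood and the peak value: on the smaller interval \<open>I\<close> the
    weight is at least \<open>m\<close>, so \<open>m^n\<close> there outgrows \<open>M^n\<close>
    outside.\<close>
  define m where "m = (M + \<phi> t\<^sub>0) / 2"
  have "M < \<phi> t\<^sub>0" using inc[of "t\<^sub>0 - e" t\<^sub>0] dec[of t\<^sub>0 "t\<^sub>0 + e"] e by (simp add: M_def)
  hence Mm: "M < m" "m < \<phi> t\<^sub>0" by (auto simp: m_def)
  have "isCont \<phi> t\<^sub>0" using der DERIV_isCont by blast
  then obtain d' where d': "d' > 0" "\<And>t. \<bar>t - t\<^sub>0\<bar> < d' \<Longrightarrow> \<bar>\<phi> t - \<phi> t\<^sub>0\<bar> < \<phi> t\<^sub>0 - m"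
    using Mm unfolding continuous_at_eps_delta dist_real_def by (meson diff_gt_0_iff_gt)
  define e' where "e' = min (d' / 2) e"
  have e': "e' > 0" "e' < d'" "e' \<le> e" using d' e by (auto simp: e'_def)
  have inner: "m \<le> \<phi> t" if "\<bar>t - t\<^sub>0\<bar> \<le> e'" for t
    using d'(2)[of t] that e' by linarith
  define I where "I = {t\<^sub>0 - e'..t\<^sub>0 + e'}"
  have I: "integrable lborel_pos (indicat_real I)" "integral\<^sup>L lborel_pos (indicat_real I) = 2 * e'"
  proof -
    have sub: "I \<subseteq> {0<..}" using e e' by (auto simp: I_def)
    have S: "I \<in> sets lborel_pos"
      using sub by (subst sets_restrict_space_iff) (simp_all add: I_def)
    have E: "emeasure lborel_pos I = ennreal (2 * e')"
      using sub e' by (subst emeasure_restrict_space) (simp_all add: I_def)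
    show "integrable lborel_pos (indicat_real I)"
      by (rule integrable_real_indicator[OF S]) (simp add: E)
    have "I \<inter> space lborel_pos = I" using S sets.sets_into_space by blast
    moreover have "measure lborel_pos I = 2 * e'"
      unfolding measure_def E using e' by simp
    ultimately show "integral\<^sup>L lborel_pos (indicat_real I) = 2 * e'"
      by (simp only: Bochner_Integration.integral_indicator)
  qed
  have mom: "integrable lborel_pos (\<lambda>t. \<phi> t ^ n * k t)" "(LINT t|lborel_pos. \<phi> t ^ n * k t) \<ge> 0"
    if "real n > \<sigma>\<^sub>0 * t\<^sub>0" for n
  proof -
    have \<sigma>: "real n / t\<^sub>0 > \<sigma>\<^sub>0" using that t0 by (simp add: field_simps)
    have eq: "\<phi> t ^ n * k t = fact n * (t ^ n / fact n * (exp (- (real n / t\<^sub>0) * t) * k t))" for t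
      by (simp add: \<phi>_def power_mult_distrib flip: exp_of_nat_mult)
    show "integrable lborel_pos (\<lambda>t. \<phi> t ^ n * k t)"
      unfolding eq by (intro integrable_mult_right int \<sigma>)
    show "(LINT t|lborel_pos. \<phi> t ^ n * k t) \<ge> 0"
      unfolding eq integral_mult_right_zero by (intro mult_nonneg_nonneg nonneg \<sigma>) auto
  qed
  \<comment> \<open>\<open>N\<close> stays fixed and makes \<open>\<phi>^N * k\<close> integrable;
    only the additional exponent \<open>j\<close> will grow.\<close>
  obtain N :: nat where N: "real N > \<sigma>\<^sub>0 * t\<^sub>0" using reals_Archimedean2 by blast
  define A where "A = (LINT t|lborel_pos. \<bar>\<phi> t ^ N * k t\<bar>)"
  have Ai: "integrable lborel_pos (\<lambda>t. \<bar>\<phi> t ^ N * k t\<bar>)" using mom(1)[OF N] by (rule integrable_abs)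
  \<comment> \<open>The moment of order \<open>N + j\<close> is nonnegative. Far from the peak it is
    controlled by \<open>M^j\<close>, near the peak but outside \<open>I\<close> the integrand is at
    most zero, and on \<open>I\<close> it is at most \<open>- c * m^(N + j)\<close>.\<close>
  have key: "c * m ^ (N + j) * (2 * e') \<le> M ^ j * A" for j
  proof -
    have pw: "\<phi> t ^ (N + j) * k t \<le> M ^ j * \<bar>\<phi> t ^ N * k t\<bar> - c * m ^ (N + j) * indicat_real I t" if t: "t > 0" for t
    proof -
      have p: "\<phi> t > 0" using pos t by blast
      consider "\<bar>t - t\<^sub>0\<bar> > e" | "\<bar>t - t\<^sub>0\<bar> \<le> e" "t \<notin> I" | "t \<in> I" by linarith
      thus ?thesis
      proof cases
        case 1
        hence "t \<notin> I" using e' by (auto simp: I_def abs_if split: if_splits)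
        moreover have "\<phi> t ^ j * (\<phi> t ^ N * k t) \<le> \<phi> t ^ j * \<bar>\<phi> t ^ N * k t\<bar>"
          using p by (intro mult_left_mono) auto
        moreover have "\<phi> t ^ j * \<bar>\<phi> t ^ N * k t\<bar> \<le> M ^ j * \<bar>\<phi> t ^ N * k t\<bar>"
          using outer[OF 1] p by (intro mult_right_mono power_mono) auto
        ultimately show ?thesis by (simp add: power_add mult_ac)
      next
        case 2
        have "\<phi> t ^ (N + j) * k t \<le> 0" using kc[OF 2(1)] c p by (intro mult_nonneg_nonpos) auto
        moreover have "0 \<le> M ^ j * \<bar>\<phi> t ^ N * k t\<bar>" using M0 by simp
        ultimately show ?thesis using 2 by (simp del: abs_mult)
      next
        case 3
        hence t3: "\<bar>t - t\<^sub>0\<bar> \<le> e'" by (auto simp: I_def abs_if)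
        have "c * m ^ (N + j) \<le> (- k t) * \<phi> t ^ (N + j)"
          using kc[of t] t3 e' inner[OF t3] Mm M0 c by (intro mult_mono power_mono) auto
        moreover have "0 \<le> M ^ j * \<bar>\<phi> t ^ N * k t\<bar>" using M0 by simp
        ultimately show ?thesis using 3 by (simp add: mult.commute)
      qed
    qed
    have Nj: "real (N + j) > \<sigma>\<^sub>0 * t\<^sub>0" using N by simp
    have "0 \<le> (LINT t|lborel_pos. \<phi> t ^ (N + j) * k t)" by (rule mom(2)[OF Nj])
    also have "\<dots> \<le> (LINT t|lborel_pos. M ^ j * \<bar>\<phi> t ^ N * k t\<bar> - c * m ^ (N + j) * indicat_real I t)"
      by (intro integral_mono mom(1)[OF Nj] Bochner_Integration.integrable_diff integrable_mult_right Ai I)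
         (use pw in \<open>auto simp: space_restrict_space\<close>)
    also have "\<dots> = M ^ j * A - c * m ^ (N + j) * (2 * e')"
      unfolding A_def I(2)[symmetric]
      by (subst Bochner_Integration.integral_diff)
         (intro integrable_mult_right Ai I, intro integrable_mult_right Ai I, simp only: integral_mult_right_zero)
    finally show ?thesis by simp
  qed
  define B where "B = c * m ^ N * (2 * e')"
  have B: "B > 0" using c e' M0 Mm by (simp add: B_def)
  have "m / M > 1" using Mm M0 by simp
  then obtain j where "A / B < (m / M) ^ j" using real_arch_pow by blast
  hence "M ^ j * A < m ^ j * B" using B M0 by (simp add: field_simps)
  thus False using key[of j] by (simp add: B_def power_add mult_ac)
qed

text \<open>Euler's integral is cut down to \<open>[T, 2 * T]\<close>, where the integrand is at
  least \<open>T powr (p - 1) * exp (- 2 * T)\<close>. As \<open>T\<close> is free,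
  \<open>Gamma p\<close> outgrows every exponential in \<open>p\<close>.\<close>

lemma Gamma_lower_bound:
  fixes p T :: real
  assumes "p \<ge> 1" "T > 0"
  shows "exp (- (2 * T)) * T powr p \<le> Gamma p"
proof -
  let ?f = "\<lambda>t. t powr (p - 1) / exp t"
  have G: "(?f has_integral Gamma p) {0..}" using assms by (intro Gamma_integral_real) auto
  have C: "?f integrable_on {T..2 * T}"
    using assms by (intro integrable_continuous_real continuous_intros) auto
  have "((\<lambda>_. exp (- (2 * T)) * T powr (p - 1)) has_integral T * (exp (- (2 * T)) * T powr (p - 1))) {T..2 * T}"
    using has_integral_const_real[of "exp (- (2 * T)) * T powr (p - 1)" T "2 * T"] assms by simp
  hence "T * (exp (- (2 * T)) * T powr (p - 1)) \<le> integral {T..2 * T} ?f"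
  proof (rule has_integral_le[OF _ integrable_integral[OF C]])
    fix t assume "t \<in> {T..2 * T}"
    hence "T powr (p - 1) * exp (- (2 * T)) \<le> t powr (p - 1) * exp (- t)"
      using assms by (intro mult_mono powr_mono2) auto
    thus "exp (- (2 * T)) * T powr (p - 1) \<le> ?f t" by (simp add: exp_minus divide_inverse mult.commute)
  qed
  also have "\<dots> \<le> Gamma p"
    by (rule has_integral_subset_le[OF _ integrable_integral[OF C] G]) (use assms in auto)
  finally show ?thesis using assms by (simp add: powr_diff mult_ac)
qed

text \<open>The binomial series converges at some \<open>w\<close> with
  \<open>\<bar>y\<bar> < w < 1\<close>, hence absolutely at \<open>y\<close>.\<close>

lemma summable_norm_gbinomial:
  fixes b y :: real
  assumes "\<bar>y\<bar> < 1"
  shows "summable (\<lambda>n. norm ((b gchoose n) * y ^ n))"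
proof -
  obtain w where w: "\<bar>y\<bar> < w" "w < 1" using assms dense by blast
  have "summable (\<lambda>n. (b gchoose n) * w ^ n)"
    using gen_binomial_real[of w b] w by (simp add: sums_iff)
  thus ?thesis by (rule powser_insidea) (use w in auto)
qed

text \<open>Zeros are isolated: a nonzero coefficient would keep the sum away from zero on a
  punctured neighbourhood of the origin.\<close>

lemma real_powser_coeffs_zero:
  fixes d :: "nat \<Rightarrow> real"
  assumes "r > 0" "\<And>h. \<bar>h\<bar> < r \<Longrightarrow> (\<lambda>n. d n * h ^ n) sums 0"
  shows "d n = 0"
proof (rule ccontr)
  assume "d n \<noteq> 0"
  have "d 0 = 0" using assms(2)[of 0] assms(1) by (simp add: sums_iff)
  with \<open>d n \<noteq> 0\<close> have "n > 0" by (cases n) auto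
  obtain s where "0 < s" "\<And>z. z \<in> cball 0 s - {0} \<Longrightarrow> (\<lambda>_::real. 0) z \<noteq> (0 :: real)"
    using powser_0_nonzero[of r 0 d "\<lambda>_. 0" n] assms \<open>d n \<noteq> 0\<close> \<open>n > 0\<close> by auto
  from this(2)[of s] this(1) show False by simp
qed

subsection \<open>The Prabhakar kernel\<close>

context
  fixes \<alpha> \<beta> :: real
begin

text \<open>The sign \<open>(-1)^n\<close> from \<open>pochhammer (- \<beta>) n / fact n\<close>
  cancels that of the negative argument, leaving a generalised binomial coefficient; termwise
  integration thus meets the binomial series.\<close>

definition kernel_coeff :: "nat \<Rightarrow> real" where
  "kernel_coeff n = (\<beta> gchoose n) * (1 - \<alpha>) ^ n / Gamma ((1 - \<alpha>) * n + \<alpha>)"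

definition kernel :: "real \<Rightarrow> real" where
  "kernel t = t powr (\<alpha> - 1) * prabhakar (- \<beta>) (1 - \<alpha>) \<alpha> (- (1 - \<alpha>) * t powr (1 - \<alpha>))"

context
  assumes \<alpha>: "0 < \<alpha>" "\<alpha> < 1" and \<beta>: "\<beta> \<ge> 0"
begin

lemma Gamma_arg_pos: "(1 - \<alpha>) * real n + \<alpha> > 0"
  using \<alpha> by (intro add_nonneg_pos) auto

lemma kernel_eq: "kernel t = t powr (\<alpha> - 1) * (\<Sum>n. kernel_coeff n * (t powr (1 - \<alpha>)) ^ n)"
proof -
  have "pochhammer (- \<beta>) n / (fact n * Gamma ((1 - \<alpha>) * real n + \<alpha>)) * (- (1 - \<alpha>) * x) ^ n =
      kernel_coeff n * x ^ n" for n x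
  proof -
    have "(- (1 - \<alpha>) * x) ^ n = (-1) ^ n * (1 - \<alpha>) ^ n * x ^ n"
      by (simp flip: power_mult_distrib)
    thus ?thesis by (simp add: kernel_coeff_def gbinomial_pochhammer)
  qed
  thus ?thesis by (simp only: kernel_def prabhakar_def)
qed

lemma summable_norm_kernel_coeff: "summable (\<lambda>n. norm (kernel_coeff n * x ^ n))"
proof -
  \<comment> \<open>\<open>y\<close> is at least twice
    \<open>(1 - \<alpha>) * \<bar>x\<bar>\<close>, and \<open>T\<close> satisfies
    \<open>T powr (1 - \<alpha>) = y\<close>. The Gamma bound then gives
    \<open>1 / Gamma \<le> C / y^n\<close>, which leaves the binomial series at \<open>1 / 2\<close>
    as a majorant.\<close>
  define y where "y = 2 * (1 - \<alpha>) * (\<bar>x\<bar> + 1)"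
  define T where "T = y powr (1 / (1 - \<alpha>))"
  have y: "y > 0" using \<alpha> by (simp add: y_def)
  hence T: "T > 0" by (simp add: T_def)
  have Tp: "T powr ((1 - \<alpha>) * real n + \<alpha>) = y ^ n * T powr \<alpha>" for n
    using y \<alpha> by (simp add: T_def powr_add powr_powr powr_realpow)
  define C where "C = exp (2 * T) / T powr \<alpha>"
  have bound: "norm (norm (kernel_coeff n * x ^ n)) \<le> C * norm ((\<beta> gchoose n) * (1 / 2) ^ n)" if n: "n \<ge> 1" "real n \<ge> 1" for n
  proof -
    \<comment> \<open>For \<open>n \<ge> 1\<close> the Gamma argument is at least \<open>1\<close>,
      as the lower bound requires.\<close>
    have "(1 - \<alpha>) * real n \<ge> (1 - \<alpha>) * 1" using n \<alpha> by (intro mult_left_mono) auto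
    hence "exp (- (2 * T)) * (y ^ n * T powr \<alpha>) \<le> Gamma ((1 - \<alpha>) * real n + \<alpha>)"
      unfolding Tp[symmetric] using T by (intro Gamma_lower_bound) auto
    moreover have "0 < exp (- (2 * T)) * (y ^ n * T powr \<alpha>)" using y T by simp
    ultimately have "inverse (Gamma ((1 - \<alpha>) * real n + \<alpha>)) \<le> inverse (exp (- (2 * T)) * (y ^ n * T powr \<alpha>))"
      by (intro le_imp_inverse_le)
    also have "\<dots> = C / y ^ n" by (simp add: C_def exp_minus field_simps)
    finally have G: "inverse (Gamma ((1 - \<alpha>) * real n + \<alpha>)) \<le> C / y ^ n" .
    have "(1 - \<alpha>) * \<bar>x\<bar> \<le> y / 2"
      using mult_left_mono[of "\<bar>x\<bar>" "\<bar>x\<bar> + 1" "1 - \<alpha>"] \<alpha> by (simp add: y_def algebra_simps)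
    hence "((1 - \<alpha>) * \<bar>x\<bar>) ^ n \<le> (y / 2) ^ n"
      using \<alpha> by (intro power_mono) auto
    hence "\<bar>\<beta> gchoose n\<bar> * ((1 - \<alpha>) * \<bar>x\<bar>) ^ n * inverse (Gamma ((1 - \<alpha>) * real n + \<alpha>)) \<le>
        \<bar>\<beta> gchoose n\<bar> * (y / 2) ^ n * (C / y ^ n)"
      using G Gamma_real_pos[OF Gamma_arg_pos[of n]] y by (intro mult_mono mult_left_mono) auto
    also have "\<dots> = C * norm ((\<beta> gchoose n) * (1 / 2) ^ n)"
      using y by (simp add: power_divide abs_mult)
    finally have "\<bar>\<beta> gchoose n\<bar> * ((1 - \<alpha>) * \<bar>x\<bar>) ^ n * inverse (Gamma ((1 - \<alpha>) * real n + \<alpha>)) \<le>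
        C * norm ((\<beta> gchoose n) * (1 / 2) ^ n)" .
    moreover have "norm (norm (kernel_coeff n * x ^ n)) =
        \<bar>\<beta> gchoose n\<bar> * ((1 - \<alpha>) * \<bar>x\<bar>) ^ n * inverse (Gamma ((1 - \<alpha>) * real n + \<alpha>))"
      using abs_of_pos[OF Gamma_real_pos[OF Gamma_arg_pos[of n]]] abs_of_pos[of "1 - \<alpha>"] \<alpha>
      by (simp only: kernel_coeff_def real_norm_def abs_abs abs_mult abs_inverse divide_inverse
            power_abs power_mult_distrib mult_ac diff_gt_0_iff_gt)
    ultimately show ?thesis by (simp only:)
  qed
  have "summable (\<lambda>n. C * norm ((\<beta> gchoose n) * (1 / 2) ^ n))"
    by (intro summable_mult summable_norm_gbinomial) simp
  thus ?thesis by (rule summable_comparison_test'[where N = 1]) (use bound in auto)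
qed

lemma isCont_kernel_series: "isCont (\<lambda>x. \<Sum>n. kernel_coeff n * x ^ n) x"
  using summable_norm_cancel[OF summable_norm_kernel_coeff]
  by (intro isCont_powser_converges_everywhere)

lemma continuous_on_kernel: "continuous_on {0<..} kernel"
proof -
  have "continuous_on {0<..} (\<lambda>t. t powr (\<alpha> - 1) * (\<Sum>n. kernel_coeff n * (t powr (1 - \<alpha>)) ^ n))"
    by (intro continuous_intros continuous_at_imp_continuous_on ballI
          isCont_o2[OF _ isCont_kernel_series] continuous_mult) auto
  moreover have "kernel = (\<lambda>t. t powr (\<alpha> - 1) * (\<Sum>n. kernel_coeff n * (t powr (1 - \<alpha>)) ^ n))"
    using kernel_eq by blast
  ultimately show ?thesis by (simp only:)
qed

lemma kernel_measurable: "kernel \<in> borel_measurable lborel_pos"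
proof -
  have "kernel \<in> borel_measurable (restrict_space borel {0<..})"
    using continuous_on_kernel by (rule borel_measurable_continuous_on_restrict)
  thus ?thesis by (simp cong: measurable_cong_sets add: sets_restrict_space)
qed

text \<open>The series is continuous in \<open>x\<close>, hence bounded on \<open>[0, 1]\<close>,
  and \<open>t powr (1 - \<alpha>)\<close> stays in this interval for
  \<open>t \<le> 1\<close>.\<close>

lemma kernel_bound:
  obtains C where "C > 0" "\<And>t. 0 < t \<Longrightarrow> t \<le> 1 \<Longrightarrow> \<bar>kernel t\<bar> \<le> C * t powr (\<alpha> - 1)"
proof -
  let ?E = "\<lambda>x. \<Sum>n. kernel_coeff n * x ^ n"
  have "compact (?E ` {0..1})"
    by (intro compact_continuous_image continuous_at_imp_continuous_on ballI isCont_kernel_series) auto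
  hence "bounded (?E ` {0..1})" by (rule compact_imp_bounded)
  then obtain C where C: "C > 0" "\<forall>y\<in>?E ` {0..1}. norm y \<le> C"
    unfolding bounded_pos by blast
  have "\<bar>kernel t\<bar> \<le> C * t powr (\<alpha> - 1)" if "0 < t" "t \<le> 1" for t
  proof -
    have "t powr (1 - \<alpha>) \<in> {0..1}" using that \<alpha> by (auto intro!: powr_le1)
    hence "\<bar>?E (t powr (1 - \<alpha>))\<bar> \<le> C" using C(2) unfolding real_norm_def by blast
    from mult_left_mono[OF this, of "t powr (\<alpha> - 1)"] show ?thesis
      by (simp add: kernel_eq abs_mult mult.commute)
  qed
  with C(1) show thesis by (rule that)
qed

section \<open>The Laplace transform at real \<open>\<sigma> > 1\<close>\<close>

lemma laplace_kernel_large: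
  assumes "\<sigma> > 1"
  shows "integrable lborel_pos (\<lambda>t. exp (- \<sigma> * t) * kernel t)"
    and "(LINT t|lborel_pos. exp (- \<sigma> * t) * kernel t) =
      \<sigma> powr (- \<alpha>) * (1 + (1 - \<alpha>) * \<sigma> powr (\<alpha> - 1)) powr \<beta>"
proof -
  define p where "p n = (1 - \<alpha>) * real n + \<alpha>" for n
  have p: "p n > 0" for n unfolding p_def by (rule Gamma_arg_pos)
  let ?f = "\<lambda>n t. kernel_coeff n * (exp (- \<sigma> * t) * t powr (p n - 1))"
  define y where "y = (1 - \<alpha>) * \<sigma> powr (\<alpha> - 1)"
  have "\<sigma> powr (\<alpha> - 1) \<le> 1" using powr_mono[of "\<alpha> - 1" 0 \<sigma>] assms \<alpha> by simp
  hence "y \<le> (1 - \<alpha>) * 1" unfolding y_def using \<alpha> by (intro mult_left_mono) auto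
  moreover have "y \<ge> 0" using \<alpha> by (simp add: y_def)
  ultimately have y: "\<bar>y\<bar> < 1" using \<alpha> by simp
  have bi: "has_bochner_integral lborel_pos (?f n) (kernel_coeff n * (Gamma (p n) * \<sigma> powr (- p n)))" for n
    using assms p by (intro has_bochner_integral_mult_right laplace_powr) auto
  \<comment> \<open>The Gamma factor from integrating a power cancels the denominator of
    \<open>kernel_coeff\<close>; what remains is a term of the binomial series for
    \<open>(1 + y) powr \<beta>\<close>.\<close>
  have val: "kernel_coeff n * (Gamma (p n) * \<sigma> powr (- p n)) = \<sigma> powr (- \<alpha>) * ((\<beta> gchoose n) * y ^ n)" for n
  proof -
    have "(\<sigma> powr (\<alpha> - 1)) ^ n = \<sigma> powr ((\<alpha> - 1) * real n)" using assms by (simp add: powr_powr flip: powr_realpow)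
    hence "\<sigma> powr (- p n) = \<sigma> powr (- \<alpha>) * (\<sigma> powr (\<alpha> - 1)) ^ n"
      by (simp add: p_def algebra_simps flip: powr_add)
    thus ?thesis using Gamma_real_pos[OF p[of n]]
      by (simp add: kernel_coeff_def y_def power_mult_distrib flip: p_def)
  qed
  have fs: "(\<lambda>n. ?f n t) = (\<lambda>n. exp (- \<sigma> * t) * t powr (\<alpha> - 1) * (kernel_coeff n * (t powr (1 - \<alpha>)) ^ n))"
    if "t > 0" for t
  proof
    fix n
    have "(t powr (1 - \<alpha>)) ^ n = t powr ((1 - \<alpha>) * real n)" using that by (simp add: powr_powr flip: powr_realpow)
    hence "t powr (p n - 1) = t powr (\<alpha> - 1) * (t powr (1 - \<alpha>)) ^ n"
      by (simp add: p_def algebra_simps flip: powr_add)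
    thus "?f n t = exp (- \<sigma> * t) * t powr (\<alpha> - 1) * (kernel_coeff n * (t powr (1 - \<alpha>)) ^ n)" by simp
  qed
  have ae: "AE t in lborel_pos. summable (\<lambda>n. norm (?f n t))"
  proof (intro AE_I2)
    fix t assume "t \<in> space lborel_pos"
    hence t: "t > 0" by (simp add: space_restrict_space)
    have "norm (?f n t) = norm (exp (- \<sigma> * t) * t powr (\<alpha> - 1)) * norm (kernel_coeff n * (t powr (1 - \<alpha>)) ^ n)" for n
      unfolding fun_cong[OF fs[OF t], of n] by (rule norm_mult)
    thus "summable (\<lambda>n. norm (?f n t))"
      by (simp only:) (intro summable_mult summable_norm_kernel_coeff)
  qed
  \<comment> \<open>Each term has constant sign in \<open>t\<close>, so the integral of its norm is
    the absolute value of its integral.\<close>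
  have "(LINT t|lborel_pos. norm (?f n t)) = \<sigma> powr (- \<alpha>) * norm ((\<beta> gchoose n) * y ^ n)" for n
  proof -
    have "norm (?f n t) = norm (kernel_coeff n) * (exp (- \<sigma> * t) * t powr (p n - 1))" for t
      by (simp add: abs_mult)
    hence "(LINT t|lborel_pos. norm (?f n t)) = norm (kernel_coeff n) * (Gamma (p n) * \<sigma> powr (- p n))"
      using has_bochner_integral_integral_eq[OF laplace_powr[of \<sigma> "p n"]] p assms
      by (simp only: integral_mult_right_zero)
    also have "\<dots> = norm (kernel_coeff n * (Gamma (p n) * \<sigma> powr (- p n)))"
      using Gamma_real_pos[OF p[of n]] by (simp add: abs_mult)
    also have "\<dots> = \<sigma> powr (- \<alpha>) * norm ((\<beta> gchoose n) * y ^ n)"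
      unfolding val by (simp add: abs_mult)
    finally show ?thesis .
  qed
  hence sm: "summable (\<lambda>n. LINT t|lborel_pos. norm (?f n t))"
    by (simp only: summable_mult summable_norm_gbinomial y)
  have ssum: "(\<Sum>n. ?f n t) = exp (- \<sigma> * t) * kernel t" if "t \<in> space lborel_pos" for t
  proof -
    have t: "t > 0" using that by (simp add: space_restrict_space)
    have "(\<Sum>n. ?f n t) = exp (- \<sigma> * t) * t powr (\<alpha> - 1) * (\<Sum>n. kernel_coeff n * (t powr (1 - \<alpha>)) ^ n)"
      unfolding fs[OF t] by (rule suminf_mult[OF summable_norm_cancel[OF summable_norm_kernel_coeff]])
    thus ?thesis by (simp only: kernel_eq mult.assoc)
  qed
  have fi: "integrable lborel_pos (?f n)" for n
    using bi[of n] by (rule integrable.intros)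
  have "integrable lborel_pos (\<lambda>t. \<Sum>n. ?f n t)"
    by (rule integrable_suminf[OF fi ae sm])
  thus "integrable lborel_pos (\<lambda>t. exp (- \<sigma> * t) * kernel t)"
    by (subst (asm) Bochner_Integration.integrable_cong[OF refl ssum])
  have "(\<lambda>n. integral\<^sup>L lborel_pos (?f n)) sums (LINT t|lborel_pos. (\<Sum>n. ?f n t))"
    by (rule sums_integral[OF fi ae sm])
  moreover have "(LINT t|lborel_pos. (\<Sum>n. ?f n t)) = (LINT t|lborel_pos. exp (- \<sigma> * t) * kernel t)"
    by (intro Bochner_Integration.integral_cong refl ssum)
  moreover have "integral\<^sup>L lborel_pos (?f n) = \<sigma> powr (- \<alpha>) * ((\<beta> gchoose n) * y ^ n)" for n
    using has_bochner_integral_integral_eq[OF bi[of n]] unfolding val .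
  ultimately have "(\<lambda>n. \<sigma> powr (- \<alpha>) * ((\<beta> gchoose n) * y ^ n)) sums (LINT t|lborel_pos. exp (- \<sigma> * t) * kernel t)"
    by (simp only:)
  moreover have "(\<lambda>n. \<sigma> powr (- \<alpha>) * ((\<beta> gchoose n) * y ^ n)) sums (\<sigma> powr (- \<alpha>) * (1 + y) powr \<beta>)"
    by (intro sums_mult gen_binomial_real y)
  ultimately show "(LINT t|lborel_pos. exp (- \<sigma> * t) * kernel t) =
      \<sigma> powr (- \<alpha>) * (1 + (1 - \<alpha>) * \<sigma> powr (\<alpha> - 1)) powr \<beta>"
    unfolding y_def by (rule sums_unique2)
qed

section \<open>Nonnegativity of the kernel and extension to the right half-plane\<close>

lemma inverse_Phi_holomorphic: "(\<lambda>s. 1 / Phi \<alpha> \<beta> s) holomorphic_on {s. Re s > 0}"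
  using inverse_Phi_has_derivative[OF \<alpha> \<beta>]
  by (intro holomorphic_onI) (auto simp: field_differentiable_def intro: has_field_derivative_at_within)

text \<open>The disc of radius \<open>\<sigma>\<close> about \<open>\<sigma>\<close> lies in the
  right half-plane, where the function is holomorphic, so its Taylor series converges to it
  there.\<close>

lemma inverse_Phi_sums:
  assumes A: "(\<lambda>h. 1 / Phi \<alpha> \<beta> (of_real \<sigma> - h)) has_fps_expansion A" and z: "norm z < \<sigma>"
  shows "(\<lambda>n. fps_nth A n * z ^ n) sums (1 / Phi \<alpha> \<beta> (of_real \<sigma> - z))"
proof (rule has_fps_expansion_imp_sums_complex[OF A, of "ereal \<sigma>"])
  have "Re w < \<sigma>" if "norm w < \<sigma>" for w using complex_Re_le_cmod[of w] that by linarith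
  hence "(\<lambda>h. (\<lambda>s. 1 / Phi \<alpha> \<beta> s) (of_real \<sigma> - h)) holomorphic_on ball 0 \<sigma>"
    by (intro holomorphic_on_compose_gen[OF _ inverse_Phi_holomorphic, unfolded o_def] holomorphic_intros) auto
  thus "(\<lambda>h. 1 / Phi \<alpha> \<beta> (of_real \<sigma> - h)) holomorphic_on eball 0 (ereal \<sigma>)"
    by simp
qed (use z in auto)

lemma kernel_abs_integrable:
  assumes "\<sigma> > 1"
  shows "integrable lborel_pos (\<lambda>t. exp (- \<sigma> * t) * \<bar>kernel t\<bar>)"
  using integrable_abs[OF laplace_kernel_large(1)[OF assms]] by (simp add: abs_mult)

text \<open>For small real \<open>h\<close>, both coefficient sequences expand
  \<open>1 / Phi\<close> at \<open>\<sigma> - h\<close>, so they agree.\<close>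

lemma kernel_moments:
  assumes \<sigma>: "\<sigma> > 1" and A: "(\<lambda>h. 1 / Phi \<alpha> \<beta> (of_real \<sigma> - h)) has_fps_expansion A"
    "nonneg_coeffs A"
  shows "integrable lborel_pos (\<lambda>t. t ^ n / fact n * (exp (- \<sigma> * t) * kernel t))"
    and "fps_nth A n = of_real (LINT t|lborel_pos. t ^ n / fact n * (exp (- \<sigma> * t) * kernel t))"
proof -
  let ?c = "\<lambda>n. LINT t|lborel_pos. t ^ n / fact n * (exp (- \<sigma> * t) * kernel t)"
  \<comment> \<open>\<open>\<sigma> - r\<close> is the midpoint of \<open>1\<close> and
    \<open>\<sigma>\<close>, so absolute integrability is already known there.\<close>
  define r where "r = (\<sigma> - 1) / 2"
  have r: "r > 0" "\<sigma> - r > 1" "r < \<sigma>" using \<sigma> by (auto simp: r_def field_simps)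
  note int = kernel_abs_integrable[OF r(2)]
  show "integrable lborel_pos (\<lambda>t. t ^ n / fact n * (exp (- \<sigma> * t) * kernel t))"
    by (rule laplace_moment_integrable[OF kernel_measurable r(1) int])
  have "(\<lambda>n. (Re (fps_nth A n) - ?c n) * h ^ n) sums 0" if h: "\<bar>h\<bar> < r" for h
  proof -
    have "(\<lambda>n. of_real (?c n) * of_real h ^ n) sums
        (LINT t|lborel_pos. exp (- (of_real \<sigma> - of_real h) * of_real t) * complex_of_real (kernel t))"
      using h by (intro laplace_taylor[OF kernel_measurable r(1) _ int]) auto
    also have "(LINT t|lborel_pos. exp (- (of_real \<sigma> - of_real h) * of_real t) * complex_of_real (kernel t)) =
        of_real (LINT t|lborel_pos. exp (- (\<sigma> - h) * t) * kernel t)"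
      by (simp flip: integral_complex_of_real exp_of_real)
    also have "\<dots> = 1 / Phi \<alpha> \<beta> (of_real (\<sigma> - h))"
      using h r by (subst laplace_kernel_large(2), simp) (subst inverse_Phi_of_real, use \<alpha> in auto)
    finally have 1: "(\<lambda>n. of_real (?c n) * of_real h ^ n) sums (1 / Phi \<alpha> \<beta> (of_real \<sigma> - of_real h))"
      by simp
    have 2: "(\<lambda>n. fps_nth A n * of_real h ^ n) sums (1 / Phi \<alpha> \<beta> (of_real \<sigma> - of_real h))"
      using h r by (intro inverse_Phi_sums A) auto
    have "(\<lambda>n. (fps_nth A n - of_real (?c n)) * of_real (h ^ n)) sums 0"
      using sums_diff[OF 2 1] by (simp add: algebra_simps)
    moreover have "Re ((a - of_real c) * of_real q) = (Re a - c) * q" for a c q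
      by simp
    ultimately show ?thesis using sums_Re[of _ 0] by (metis (no_types, lifting) sums_cong zero_complex.sel(1))
  qed
  \<comment> \<open>Comparing real parts is enough, because the coefficients of \<open>A\<close> are
    real.\<close>
  hence "Re (fps_nth A n) - ?c n = 0" by (rule real_powser_coeffs_zero[OF r(1)])
  moreover have "fps_nth A n = of_real (Re (fps_nth A n))"
    using A(2) by (auto simp: nonneg_coeffs_def complex_nonneg_Reals_iff complex_eq_iff)
  ultimately show "fps_nth A n = of_real (?c n)" by simp
qed

lemma kernel_nonneg: "t > 0 \<Longrightarrow> kernel t \<ge> 0"
proof (rule nonneg_if_laplace_moments_nonneg[OF continuous_on_kernel, of 1])
  fix \<sigma> :: real and n assume \<sigma>: "\<sigma> > 1"
  then obtain A where A: "(\<lambda>h. 1 / Phi \<alpha> \<beta> (of_real \<sigma> - h)) has_fps_expansion A" "nonneg_coeffs A"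
    using inverse_Phi_expansion[OF \<alpha> \<beta>, of \<sigma>] by auto
  show "integrable lborel_pos (\<lambda>t. t ^ n / fact n * (exp (- \<sigma> * t) * kernel t))"
    by (rule kernel_moments[OF \<sigma> A])
  show "(LINT t|lborel_pos. t ^ n / fact n * (exp (- \<sigma> * t) * kernel t)) \<ge> 0"
    using A(2) kernel_moments(2)[OF \<sigma> A, of n] by (metis nonneg_coeffs_def nonneg_Reals_of_real_iff)
qed

lemma laplace_kernel:
  assumes s: "Re s > 0"
  shows "integrable lborel_pos (\<lambda>t. exp (- s * of_real t) * of_real (kernel t))"
    and "(LINT t|lborel_pos. exp (- s * of_real t) * of_real (kernel t)) = 1 / Phi \<alpha> \<beta> s"
proof -
  \<comment> \<open>\<open>s\<close> lies in the disc of radius \<open>\<sigma>\<close> around \<open>\<sigma>\<close> iff \<open>2 * \<sigma> * Re s > (norm s)\<^sup>2\<close>.\<close>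
  define \<sigma> where "\<sigma> = (norm s)\<^sup>2 / (2 * Re s) + 2"
  have \<sigma>1: "\<sigma> > 1"
  proof -
    have "(norm s)\<^sup>2 / (2 * Re s) \<ge> 0" using s by simp
    thus ?thesis unfolding \<sigma>_def by linarith
  qed
  define z where "z = of_real \<sigma> - s"
  have "(norm z)\<^sup>2 = \<sigma>\<^sup>2 - 2 * \<sigma> * Re s + (norm s)\<^sup>2"
    unfolding z_def cmod_power2 by (simp add: power2_eq_square algebra_simps)
  moreover have "2 * \<sigma> * Re s = (norm s)\<^sup>2 + 4 * Re s"
    using s by (simp add: \<sigma>_def field_simps)
  ultimately have "(norm z)\<^sup>2 < \<sigma>\<^sup>2" using s by simp
  hence z: "norm z < \<sigma>" by (rule power2_less_imp_less) (use \<sigma>1 in simp)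
  \<comment> \<open>Strictly between \<open>norm z\<close> and \<open>\<sigma>\<close>: the Taylor
    series converges at \<open>r\<close>, which yields integrability at \<open>\<sigma> - r\<close>,
    and \<open>z\<close> lies in the disc that \<open>laplace_taylor\<close> then covers.\<close>
  define r where "r = (norm z + \<sigma>) / 2"
  have r: "r > 0" "norm z \<le> r" "r < \<sigma>" using z \<sigma>1 by (auto simp: r_def intro: add_nonneg_pos)
  obtain A where A: "(\<lambda>h. 1 / Phi \<alpha> \<beta> (of_real \<sigma> - h)) has_fps_expansion A" "nonneg_coeffs A"
    using inverse_Phi_expansion[OF \<alpha> \<beta>, of \<sigma>] \<sigma>1 by auto
  note mom = kernel_moments[OF \<sigma>1 A]
  have "(\<lambda>n. fps_nth A n * of_real r ^ n) sums (1 / Phi \<alpha> \<beta> (of_real \<sigma> - of_real r))"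
    using r by (intro inverse_Phi_sums A) auto
  hence "summable (\<lambda>n. complex_of_real ((LINT t|lborel_pos. t ^ n / fact n * (exp (- \<sigma> * t) * kernel t)) * r ^ n))"
    unfolding mom(2) by (simp only: sums_iff of_real_mult of_real_power)
  hence "summable (\<lambda>n. (LINT t|lborel_pos. t ^ n / fact n * (exp (- \<sigma> * t) * kernel t)) * r ^ n)"
    by (simp only: summable_of_real_iff)
  hence int: "integrable lborel_pos (\<lambda>t. exp (- (\<sigma> - r) * t) * kernel t)"
    using r by (intro laplace_integrable_extend kernel_nonneg mom(1)) auto
  hence int': "integrable lborel_pos (\<lambda>t. exp (- (\<sigma> - r) * t) * \<bar>kernel t\<bar>)"
    using integrable_abs[OF int] by (simp add: abs_mult)
  have sz: "of_real \<sigma> - z = s" by (simp add: z_def)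
  have "(\<lambda>n. fps_nth A n * z ^ n) sums (LINT t|lborel_pos. exp (- (of_real \<sigma> - z) * of_real t) * of_real (kernel t))"
    unfolding mom(2) by (rule laplace_taylor[OF kernel_measurable r(1,2) int'])
  moreover have "(\<lambda>n. fps_nth A n * z ^ n) sums (1 / Phi \<alpha> \<beta> (of_real \<sigma> - z))"
    by (rule inverse_Phi_sums[OF A(1) z])
  ultimately show "(LINT t|lborel_pos. exp (- s * of_real t) * of_real (kernel t)) = 1 / Phi \<alpha> \<beta> s"
    unfolding sz by (rule sums_unique2)
  show "integrable lborel_pos (\<lambda>t. exp (- s * of_real t) * of_real (kernel t))"
  proof (rule Bochner_Integration.integrable_bound[OF int'])
    show "(\<lambda>t. exp (- s * of_real t) * of_real (kernel t)) \<in> borel_measurable lborel_pos"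
      using kernel_measurable by (intro borel_measurable_times) (auto simp: measurable_restrict_space1)
    \<comment> \<open>\<open>Re s = \<sigma> - Re z\<close> and
      \<open>Re z \<le> norm z \<le> r\<close>, so the integrand at \<open>s\<close> is dominated by
      the one at \<open>\<sigma> - r\<close>.\<close>
    have le: "\<sigma> - r \<le> Re s" using complex_Re_le_cmod[of z] r(2) by (simp add: z_def)
    have "exp (- (Re s * t)) * \<bar>kernel t\<bar> \<le> exp (- (\<sigma> - r) * t) * \<bar>kernel t\<bar>" if "t > 0" for t
    proof (rule mult_right_mono)
      have "(\<sigma> - r) * t \<le> Re s * t" using le that by (intro mult_right_mono) auto
      thus "exp (- (Re s * t)) \<le> exp (- (\<sigma> - r) * t)"
        by (simp only: exp_le_cancel_iff mult_minus_left neg_le_iff_le)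
    qed simp
    thus "AE t in lborel_pos. norm (exp (- s * of_real t) * of_real (kernel t)) \<le> norm (exp (- (\<sigma> - r) * t) * \<bar>kernel t\<bar>)"
      by (intro AE_I2) (auto simp: space_restrict_space norm_mult)
  qed
qed

text \<open>On a bounded interval the weight \<open>exp (- 2 * t)\<close> can be undone by the
  bounded factor \<open>exp (2 * t)\<close>; any exponent above \<open>1\<close> would serve in
  place of \<open>2\<close>.\<close>

lemma L1_loc_kernel: "L1_loc kernel"
  unfolding L1_loc_def
proof (intro allI impI)
  fix T :: real assume "T > 0"
  have "set_integrable lebesgue {0<..} (\<lambda>t. exp (- 2 * t) * kernel t)"
    by (intro integrable_lborel_pos_imp_lebesgue laplace_kernel_large) auto
  hence i: "set_integrable lebesgue {0<..<T} (\<lambda>t. exp (- 2 * t) * kernel t)"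
    by (rule set_integrable_subset) auto
  have "(\<lambda>t. exp (2 * t) * (exp (- 2 * t) * kernel t)) absolutely_integrable_on {0<..<T}"
  proof (rule absolutely_integrable_bounded_measurable_product_real[OF _ _ _ i])
    show "(\<lambda>t. exp (2 * t) :: real) \<in> borel_measurable (lebesgue_on {0<..<T})"
      by (intro continuous_imp_measurable_on_sets_lebesgue continuous_intros) auto
    show "bounded ((\<lambda>t. exp (2 * t) :: real) ` {0<..<T})"
      by (rule bounded_subset[of "{0..exp (2 * T)}"]) auto
  qed auto
  moreover have "exp (2 * t) * (exp (- 2 * t) * kernel t) = kernel t" for t
    by (simp add: exp_minus field_simps)
  ultimately show "kernel absolutely_integrable_on {0<..<T}" by (simp only:)
qed

end

end

theorem lemma4p6:
  fixes \<alpha> \<beta> :: real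
  assumes "0 < \<alpha>" and "\<alpha> < 1" and "\<beta> \<ge> 0"
  shows "\<exists>k :: real \<Rightarrow> real.
           L1_loc k \<and>
           (\<forall>s :: complex. Re s > 0 \<longrightarrow>
              has_laplace (\<lambda>t. of_real (k t)) s (1 / Phi \<alpha> \<beta> s)) \<and>
           (\<forall>t>0. k t = t powr (\<alpha> - 1) *
              prabhakar (- \<beta>) (1 - \<alpha>) \<alpha> (- (1 - \<alpha>) * t powr (1 - \<alpha>))) \<and>
           (\<exists>C>0. \<forall>t. 0 < t \<and> t \<le> 1 \<longrightarrow> \<bar>k t\<bar> \<le> C * t powr (\<alpha> - 1))"
proof (intro exI[of _ "kernel \<alpha> \<beta>"] conjI allI impI)
  show "L1_loc (kernel \<alpha> \<beta>)" by (rule L1_loc_kernel[OF assms])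
next
  fix s :: complex assume s: "Re s > 0"
  note i = integrable_lborel_pos_imp_lebesgue[OF laplace_kernel(1)[OF assms s]]
  show "has_laplace (\<lambda>t. of_real (kernel \<alpha> \<beta> t)) s (1 / Phi \<alpha> \<beta> s)"
    unfolding has_laplace_def
    by (rule conjI[OF i(1) trans[OF i(2) laplace_kernel(2)[OF assms s]]])
next
  fix t :: real
  show "kernel \<alpha> \<beta> t = t powr (\<alpha> - 1) *
              prabhakar (- \<beta>) (1 - \<alpha>) \<alpha> (- (1 - \<alpha>) * t powr (1 - \<alpha>))"
    by (rule kernel_def)
next
  show "\<exists>C>0. \<forall>t. 0 < t \<and> t \<le> 1 \<longrightarrow> \<bar>kernel \<alpha> \<beta> t\<bar> \<le> C * t powr (\<alpha> - 1)"
    using kernel_bound[OF assms] by metis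
qed

end
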